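(* Let $r\ge2$, $\ell\ge2$. In the ring $\widehat{\mathcal{T}}_{2\ell}(A_{2r+1})$ the following hold for all $1\le a\le2r+1$, $1\le m\le2\ell-1$, $u\in\frac12\mathbb{Z}$: (1) $S^{(a)}_m(u+r+1+\ell)=(-1)^mS^{(2r+2-a)}_{2\ell-m}(u)=S^{(a)}_{2\ell-m}(u)$; (2) $S^{(a)}_m(u+2(r+1+\ell))=S^{(a)}_m(u)$.
   Context: $\widehat{\mathcal{T}}_{2\ell}(A_{2r+1})$ is the commutative ring with generators $S^{(a)}_m(u)^{\pm1}$ ($1\le a\le2r+1$, $1\le m\le2\ell-1$, $u\in\frac12\mathbb{Z}$, excluding $a=r+1$ with $m$ odd), where one sets $S^{(r+1)}_m(u)=0$ for odd $m$, with relations: $S^{(a)}_m(u-\frac12)S^{(a)}_m(u+\frac12)=S^{(a)}_{m-1}(u)S^{(a)}_{m+1}(u)+S^{(a-1)}_m(u)S^{(a+1)}_m(u)$ for all $1\le a\le2r+1$, $1\le m\le2\ell-1$, $u\in\frac12\mathbb{Z}$; $S^{(a)}_m(u)=(-1)^mS^{(2r+2-a)}_m(u)$ (quasi-symmetric condition); and on right sides $S^{(a)}_0(u)=S^{(a)}_{2\ell}(u)=S^{(0)}_m(u)=1$, $S^{(2r+2)}_m(u)=(-1)^m$. *)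

theory Defs
  imports Main
begin

text \<open>A family S a m k (k :: int encodes the spectral parameter u = k/2) with values in a
commutative ring satisfying the defining relations of the ring T-hat_{2l}(A_{2r+1}):
generators are units, S^{(r+1)}_m = 0 for odd m, boundary conventions, the T-system
relation and the quasi-symmetric condition. An identity holds in the presented ring
iff it holds for every such family in every commutative ring (universal property).\<close>

definition is_T_sol :: "nat \<Rightarrow> nat \<Rightarrow> (nat \<Rightarrow> nat \<Rightarrow> int \<Rightarrow> 'a::comm_ring_1) \<Rightarrow> bool" where
"is_T_sol r l S \<longleftrightarrow>
  (\<forall>a\<in>{1..2*r+1}. \<forall>m\<in>{1..2*l-1}. \<forall>k. (a \<noteq> r+1 \<or> even m) \<longrightarrow> S a m k dvd 1) \<and>
  (\<forall>m\<in>{1..2*l-1}. odd m \<longrightarrow> (\<forall>k. S (r+1) m k = 0)) \<and>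
  (\<forall>a\<in>{1..2*r+1}. \<forall>k. S a 0 k = 1 \<and> S a (2*l) k = 1) \<and>
  (\<forall>m\<in>{1..2*l-1}. \<forall>k. S 0 m k = 1 \<and> S (2*r+2) m k = (-1)^m) \<and>
  (\<forall>a\<in>{1..2*r+1}. \<forall>m\<in>{1..2*l-1}. \<forall>k.
      S a m (k - 1) * S a m (k + 1) = S a (m - 1) k * S a (m + 1) k + S (a - 1) m k * S (a + 1) m k) \<and>
  (\<forall>a\<in>{1..2*r+1}. \<forall>m\<in>{1..2*l-1}. \<forall>k. S a m k = (-1)^m * S (2*r+2-a) m k)"

end

theory Submission
  imports Defs "Jordan_Normal_Form.Char_Poly"
begin

text \<open>Put h = 2r + 2, L = 2l and let t be the column m = 1 of a solution, extended by zero. The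
Jacobi--Trudi determinants of t satisfy the T-system by the Desnanot--Jacobi identity, so they agree
with S for m \<open>\<le>\<close> L wherever one can divide by S. The only zero divisions occur at a = r + 1 with m
odd, where the quasi-symmetry makes the determinant alternating of odd size, hence zero. The
truncation S = 1 at m = L then forces all determinants of size L + 1 to vanish.

The row a = 1 solves the linear recurrence of order h with coefficients t. The vanishing
determinants give h - 1 consecutive zeros of this sequence after index L, so the recurrence can be
run backwards from there; quasi-symmetry identifies the backward recurrence with the one of the
solution reflected in the spectral parameter, which is the half-periodicity for a = 1. The T-system
propagates it to a \<open>\<le>\<close> r + 1, where all divisors are units, and quasi-symmetry to the remaining a.\<close>

section \<open>Determinant expansions and the Desnanot--Jacobi identity\<close>

lemma det_first_col_single:
  fixes A :: "'a::comm_ring_1 mat"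
  assumes A: "A \<in> carrier_mat (Suc n) (Suc n)"
    and z: "\<And>i. 0 < i \<Longrightarrow> i < Suc n \<Longrightarrow> A $$ (i, 0) = 0"
  shows "det A = A $$ (0, 0) * det (mat_delete A 0 0)"
proof -
  have "det A = (\<Sum>i<Suc n. A $$ (i, 0) * cofactor A i 0)"
    by (rule laplace_expansion_column[OF A]) simp
  also have "\<dots> = A $$ (0, 0) * cofactor A 0 0"
    by (subst sum.lessThan_Suc_shift) (simp add: z)
  finally show ?thesis by (simp add: cofactor_def)
qed

lemma det_last_col_single:
  fixes A :: "'a::comm_ring_1 mat"
  assumes A: "A \<in> carrier_mat (Suc n) (Suc n)"
    and z: "\<And>i. i < n \<Longrightarrow> A $$ (i, n) = 0"
  shows "det A = A $$ (n, n) * det (mat_delete A n n)"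
proof -
  have "det A = (\<Sum>i<Suc n. A $$ (i, n) * cofactor A i n)"
    by (rule laplace_expansion_column[OF A]) simp
  also have "\<dots> = A $$ (n, n) * cofactor A n n"
    by (simp add: z)
  finally show ?thesis by (simp add: cofactor_def)
qed

text \<open>Row 0 has only its two outer entries, so its expansion has two terms. With cofactors as
  \<open>u\<close> and \<open>v\<close> the result is the 2 by 2 corner minor of the adjugate, the
  bilinear side of Desnanot--Jacobi.\<close>

lemma det_identity_except_outer_cols:
  fixes u v :: "nat \<Rightarrow> 'a::comm_ring_1"
  shows "det (mat (Suc (Suc n)) (Suc (Suc n))
      (\<lambda>(i, j). if j = 0 then u i else if j = Suc n then v i else if i = j then 1 else 0))
    = u 0 * v (Suc n) - v 0 * u (Suc n)" (is "det ?X = _")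
proof -
  let ?N = "Suc (Suc n)"
  have X: "?X \<in> carrier_mat ?N ?N" by simp
  have c1: "det (mat_delete ?X 0 0) = v (Suc n)"
  proof -
    have "det (mat_delete ?X 0 0) = prod_list (diag_mat (mat_delete ?X 0 0))"
      by (rule det_upper_triangular[of _ "Suc n"])
        (auto simp: upper_triangular_def mat_delete_def)
    also have "\<dots> = (\<Prod>i = 0..<Suc n. mat_delete ?X 0 0 $$ (i, i))"
      by (simp add: prod_list_diag_prod)
    also have "\<dots> = v (Suc n)" by (simp add: mat_delete_def)
    finally show ?thesis .
  qed
  have c2: "det (mat_delete ?X 0 (Suc n)) = (-1)^n * u (Suc n)"
  proof -
    let ?Y = "mat_delete ?X 0 (Suc n)"
    have Y: "?Y \<in> carrier_mat (Suc n) (Suc n)" by (simp add: mat_delete_def)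
    have "det ?Y = (\<Sum>j<Suc n. ?Y $$ (n, j) * cofactor ?Y n j)"
      by (rule laplace_expansion_row[OF Y]) simp
    also have "\<dots> = ?Y $$ (n, 0) * cofactor ?Y n 0"
      by (subst sum.lessThan_Suc_shift) (simp add: mat_delete_def)
    also have "mat_delete ?Y n 0 = 1\<^sub>m n"
      by (rule eq_matI) (auto simp: mat_delete_def)
    then have "cofactor ?Y n 0 = (-1)^n" by (simp add: cofactor_def)
    also have "?Y $$ (n, 0) = u (Suc n)" by (simp add: mat_delete_def)
    finally show ?thesis by (simp add: mult.commute)
  qed
  have "det ?X = (\<Sum>j<?N. ?X $$ (0, j) * cofactor ?X 0 j)"
    by (rule laplace_expansion_row[OF X]) simp
  also have "\<dots> = ?X $$ (0, Suc n) * cofactor ?X 0 (Suc n) + ?X $$ (0, 0) * cofactor ?X 0 0"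
    by (subst sum.lessThan_Suc, subst sum.lessThan_Suc_shift) simp
  also have "\<dots> = v 0 * ((-1)^Suc n * ((-1)^n * u (Suc n))) + u 0 * v (Suc n)"
    unfolding cofactor_def c1 c2 by simp
  finally show ?thesis by (simp add: flip: mult.assoc power_mult_distrib)
qed

text \<open>Multiply A by the identity matrix whose outer columns are replaced by those of the adjugate.\<close>

lemma det_mult_desnanot_jacobi:
  fixes A :: "'a::comm_ring_1 mat"
  assumes A: "A \<in> carrier_mat (Suc (Suc n)) (Suc (Suc n))"
  shows "det A * (det (mat_delete A 0 0) * det (mat_delete A (Suc n) (Suc n))
      - det (mat_delete A 0 (Suc n)) * det (mat_delete A (Suc n) 0))
    = det A * (det A * det (mat_delete (mat_delete A 0 0) n n))"
proof -
  let ?N = "Suc (Suc n)"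
  define X where "X = mat ?N ?N (\<lambda>(i, j). if j = 0 then cofactor A 0 i
     else if j = Suc n then cofactor A (Suc n) i else if i = j then 1 else 0)"
  have X: "X \<in> carrier_mat ?N ?N" by (simp add: X_def)
  have adj: "(\<Sum>k<?N. A $$ (i, k) * cofactor A j k) = (if i = j then det A else 0)"
    if "i < ?N" "j < ?N" for i j
  proof -
    have "(A * adj_mat A) $$ (i, j) = (\<Sum>k<?N. A $$ (i, k) * cofactor A j k)"
      using that A by (auto simp: adj_mat_def scalar_prod_def lessThan_atLeast0 intro!: sum.cong)
    with that adj_mat(2)[OF A] show ?thesis
      by (cases "i = j") (simp_all del: sum.lessThan_Suc)
  qed
  \<comment> \<open>By the adjugate relation the outer columns of \<open>A * X\<close> are
    \<open>det A\<close> times the first and last unit vectors, so its determinant is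
    \<open>det A\<close> squared times the inner minor.\<close>
  have AX: "A * X = mat ?N ?N (\<lambda>(i, j). if j = 0 then (if i = 0 then det A else 0)
     else if j = Suc n then (if i = Suc n then det A else 0) else A $$ (i, j))" (is "_ = ?B")
  proof (rule eq_matI)
    fix i j assume "i < dim_row ?B" "j < dim_col ?B"
    then have ij: "i < ?N" "j < ?N" by auto
    have e: "(A * X) $$ (i, j) = (\<Sum>k<?N. A $$ (i, k) * X $$ (k, j))"
      using ij A X by (auto simp: scalar_prod_def lessThan_atLeast0 intro!: sum.cong)
    consider "j = 0" | "j = Suc n" | "j \<noteq> 0" "j \<noteq> Suc n" by auto
    then show "(A * X) $$ (i, j) = ?B $$ (i, j)"
    proof cases
      case 1
      have "(A * X) $$ (i, j) = (\<Sum>k<?N. A $$ (i, k) * cofactor A 0 k)"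
        unfolding e by (rule sum.cong) (auto simp: X_def 1)
      then show ?thesis using adj[of i 0] ij 1 by simp
    next
      case 2
      have "(A * X) $$ (i, j) = (\<Sum>k<?N. A $$ (i, k) * cofactor A (Suc n) k)"
        unfolding e by (rule sum.cong) (auto simp: X_def 2)
      then show ?thesis using adj[of i "Suc n"] ij 2 by simp
    next
      case 3
      have "(A * X) $$ (i, j) = (\<Sum>k<?N. if k = j then A $$ (i, k) else 0)"
        unfolding e using 3 ij by (intro sum.cong) (auto simp: X_def)
      also have "\<dots> = A $$ (i, j)" using ij by simp
      finally show ?thesis using ij 3 by simp
    qed
  qed (use A X in auto)
  have dB: "det ?B = det A * (det A * det (mat_delete (mat_delete A 0 0) n n))"
  proof -
    have "det ?B = ?B $$ (0, 0) * det (mat_delete ?B 0 0)"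
      by (rule det_first_col_single[of _ "Suc n"]) auto
    also have "det (mat_delete ?B 0 0)
        = mat_delete ?B 0 0 $$ (n, n) * det (mat_delete (mat_delete ?B 0 0) n n)"
      by (rule det_last_col_single[of _ n]) (auto simp: mat_delete_def)
    also have "mat_delete (mat_delete ?B 0 0) n n = mat_delete (mat_delete A 0 0) n n"
      using A by (intro eq_matI) (auto simp: mat_delete_def)
    finally show ?thesis by (simp add: mat_delete_def)
  qed
  have dX: "det X = cofactor A 0 0 * cofactor A (Suc n) (Suc n)
      - cofactor A (Suc n) 0 * cofactor A 0 (Suc n)"
    unfolding X_def by (rule det_identity_except_outer_cols)
  have "det A * det X = det ?B" using det_mult[OF A X] AX by simp
  moreover have "det X = det (mat_delete A 0 0) * det (mat_delete A (Suc n) (Suc n))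
      - det (mat_delete A 0 (Suc n)) * det (mat_delete A (Suc n) 0)"
  proof -
    have s: "(- 1 :: 'a) ^ (n + n) = 1" by (simp flip: mult_2)
    show ?thesis unfolding dX cofactor_def
      by (simp add: s algebra_simps flip: power_add)
  qed
  ultimately show ?thesis using dB by simp
qed

text \<open>The top coefficient of the product is that of \<open>q\<close>, so a monic polynomial is
  regular even when the coefficient ring has zero divisors.\<close>

lemma monic_mult_cancel:
  fixes p q :: "'a::comm_ring_1 poly"
  assumes "lead_coeff p = 1" "p * q = 0"
  shows "q = 0"
proof -
  have "coeff (p * q) (degree p + degree q) = lead_coeff q"
    using assms(1) by (simp add: coeff_mult_degree_sum)
  then show ?thesis using assms(2) by simp
qed

text \<open>The factor det A is cancelled after perturbing A to the generic matrix x + A, whose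
determinant is monic in x.\<close>

lemma desnanot_jacobi:
  fixes A :: "'a::comm_ring_1 mat"
  assumes A: "A \<in> carrier_mat (Suc (Suc n)) (Suc (Suc n))"
  shows "det A * det (mat_delete (mat_delete A 0 0) n n)
    = det (mat_delete A 0 0) * det (mat_delete A (Suc n) (Suc n))
      - det (mat_delete A 0 (Suc n)) * det (mat_delete A (Suc n) 0)"
proof -
  define P where "P = char_poly_matrix (- A)"
  have P: "P \<in> carrier_mat (Suc (Suc n)) (Suc (Suc n))" using A by (simp add: P_def)
  have "lead_coeff (det P) = 1"
    using degree_monic_char_poly[of "- A" "Suc (Suc n)"] A by (simp add: P_def char_poly_def)
  moreover have "det P * (det P * det (mat_delete (mat_delete P 0 0) n n)
    - (det (mat_delete P 0 0) * det (mat_delete P (Suc n) (Suc n))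
      - det (mat_delete P 0 (Suc n)) * det (mat_delete P (Suc n) 0))) = 0"
    using det_mult_desnanot_jacobi[OF P] by (simp add: right_diff_distrib)
  ultimately have P0: "det P * det (mat_delete (mat_delete P 0 0) n n)
    - (det (mat_delete P 0 0) * det (mat_delete P (Suc n) (Suc n))
      - det (mat_delete P 0 (Suc n)) * det (mat_delete P (Suc n) 0)) = 0"
    by (rule monic_mult_cancel)
  \<comment> \<open>Evaluation at 0 is a ring homomorphism, hence commutes with determinants, and it
    sends \<open>P\<close> back to \<open>A\<close>.\<close>
  have ev: "comm_ring_hom (\<lambda>p :: 'a poly. poly p 0)"
    by unfold_locales auto
  let ?e = "map_mat (\<lambda>p :: 'a poly. poly p 0)"
  have del: "?e (mat_delete M i j) = mat_delete (?e M) i j" for M :: "'a poly mat" and i j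
    by (rule eq_matI) (auto simp: mat_delete_def)
  have PA: "?e P = A"
    using A by (intro eq_matI) (auto simp: P_def char_poly_matrix_def one_mat_def)
  have d: "poly (det M) 0 = det (?e M)" for M :: "'a poly mat"
    by (rule comm_ring_hom.hom_det[OF ev, symmetric])
  show ?thesis using arg_cong[OF P0, of "\<lambda>p. poly p 0"]
    by (simp add: d del PA)
qed

section \<open>Alternating determinants of odd size\<close>

lemma prod_permutes_inv:
  fixes f :: "nat \<Rightarrow> nat \<Rightarrow> 'a::comm_monoid_mult"
  assumes "p permutes {0..<n}"
  shows "(\<Prod>i = 0..<n. f i (Hilbert_Choice.inv p i)) = (\<Prod>i = 0..<n. f (p i) i)"
  by (rule prod.reindex_bij_witness[of _ p "Hilbert_Choice.inv p"])
    (use permutes_inverses[OF assms] permutes_in_image[OF assms]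
      permutes_in_image[OF permutes_inv[OF assms]] in auto)

text \<open>The Leibniz terms of p and its inverse cancel, and an involution of an odd set has a fixed
point. This argument, unlike det A = - det A, also covers characteristic 2.\<close>

lemma det_alternating_odd:
  fixes A :: "'a::comm_ring_1 mat"
  assumes A: "A \<in> carrier_mat n n" and n: "odd n"
    and diag: "\<And>i. i < n \<Longrightarrow> A $$ (i, i) = 0"
    and skew: "\<And>i j. i < n \<Longrightarrow> j < n \<Longrightarrow> A $$ (i, j) = - A $$ (j, i)"
  shows "det A = 0"
proof -
  let ?P = "{p. p permutes {0..<n}}"
  define t where "t p = signof p * (\<Prod>i = 0..<n. A $$ (i, p i))" for p
  have fin: "finite ?P" by (simp add: finite_permutations)
  have t_inv: "t (Hilbert_Choice.inv p) = - t p" if p: "p permutes {0..<n}" for p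
  proof -
    have "(\<Prod>i = 0..<n. A $$ (i, Hilbert_Choice.inv p i)) = (\<Prod>i = 0..<n. A $$ (p i, i))"
      by (rule prod_permutes_inv[OF p])
    also have "\<dots> = (\<Prod>i = 0..<n. - A $$ (i, p i))"
      by (rule prod.cong[OF refl], rule skew) (use permutes_in_image[OF p] in auto)
    also have "\<dots> = - (\<Prod>i = 0..<n. A $$ (i, p i))"
      using n by (simp add: prod_uminus)
    finally have "(\<Prod>i = 0..<n. A $$ (i, Hilbert_Choice.inv p i)) = - (\<Prod>i = 0..<n. A $$ (i, p i))" .
    moreover have "sign (Hilbert_Choice.inv p) = sign p"
      using p by (intro sign_inverse) (auto simp: permutation_permutes)
    ultimately show ?thesis by (simp add: t_def)
  qed
  have t_invol: "t p = 0" if p: "p permutes {0..<n}" and pp: "Hilbert_Choice.inv p = p" for p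
  proof -
    have "\<exists>i\<in>{0..<n}. p i = i"
    proof (rule ccontr)
      assume *: "\<not> ?thesis"
      have inv2: "p (p i) = i" for i using permutes_inverses(1)[OF p, of i] pp by simp
      have "even (card {0..<n})"
      proof -
        \<comment> \<open>Without fixed points the orbits of the involution are pairs that partition
          the index set.\<close>
        let ?Q = "(\<lambda>i. {i, p i}) ` {0..<n}"
        have U: "\<Union>?Q = {0..<n}"
        proof
          show "\<Union>?Q \<subseteq> {0..<n}" using permutes_in_image[OF p] by blast
        qed blast
        have "card (\<Union>?Q) = sum card ?Q"
        proof (rule card_Union_disjoint)
          show "pairwise disjnt ?Q"
          proof (rule pairwiseI)
            fix X Y assume "X \<in> ?Q" "Y \<in> ?Q" "X \<noteq> Y"
            then obtain i j where ij: "X = {i, p i}" "Y = {j, p j}" by blast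
            show "disjnt X Y"
            proof (rule ccontr)
              assume "\<not> disjnt X Y"
              then consider "i = j" | "i = p j" | "p i = j" | "p i = p j"
                unfolding ij disjnt_def by blast
              then have "X = Y" unfolding ij by cases (metis inv2 insert_commute)+
              with \<open>X \<noteq> Y\<close> show False by blast
            qed
          qed
        qed blast
        also have "\<dots> = sum (\<lambda>_. 2) ?Q"
        proof (rule sum.cong[OF refl])
          fix X assume "X \<in> ?Q"
          then obtain i where "i \<in> {0..<n}" "X = {i, p i}" by blast
          with * show "card X = 2" unfolding card_2_iff by metis
        qed
        finally have "card {0..<n} = 2 * card ?Q" unfolding U by simp
        then show ?thesis by (metis dvd_triv_left)
      qed
      with n show False by simp
    qed
    then obtain i where "i < n" "p i = i" by auto
    then have "(\<Prod>i = 0..<n. A $$ (i, p i)) = 0"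
      using diag by (intro prod_zero) (auto intro!: bexI[of _ i])
    then show ?thesis by (simp add: t_def)
  qed
  \<comment> \<open>An injective numbering of the permutations selects one member of each pair
    \<open>p\<close>, \<open>inv p\<close>; equal numbers mean that \<open>p\<close> is an
    involution.\<close>
  obtain e :: "(nat \<Rightarrow> nat) \<Rightarrow> nat" where e: "inj_on e ?P"
    using finite_imp_inj_to_nat_seg[OF fin] by metis
  let ?L = "{p \<in> ?P. e p < e (Hilbert_Choice.inv p)}" and ?G = "{p \<in> ?P. e (Hilbert_Choice.inv p) < e p}"
    and ?E = "{p \<in> ?P. e (Hilbert_Choice.inv p) = e p}"
  have inv_inv: "Hilbert_Choice.inv (Hilbert_Choice.inv p) = p" if "p permutes {0..<n}" for p
    using that by (simp add: inv_inv_eq permutes_bij)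
  have E: "sum t ?E = 0"
    proof (rule sum.neutral, rule ballI)
    fix p assume p: "p \<in> ?E"
    then have "Hilbert_Choice.inv p = p"
      by (intro inj_onD[OF e]) (auto intro: permutes_inv)
    then show "t p = 0" using t_invol p by simp
  qed
  have "sum t ?G = (\<Sum>p\<in>?L. t (Hilbert_Choice.inv p))"
    by (rule sum.reindex_bij_witness[of _ "Hilbert_Choice.inv" "Hilbert_Choice.inv"]) (auto simp: inv_inv permutes_inv)
  also have "\<dots> = - sum t ?L"
    by (simp add: t_inv sum_negf)
  finally have G: "sum t ?G = - sum t ?L" .
  have "det A = sum t ?P" by (simp add: det_def'[OF A] t_def)
  also have "?P = ?L \<union> (?G \<union> ?E)" by auto
  also have "sum t (?L \<union> (?G \<union> ?E)) = sum t ?L + (sum t ?G + sum t ?E)"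
    using fin by (subst sum.union_disjoint, (auto)[3], subst sum.union_disjoint) auto
  finally show ?thesis using E G by simp
qed

section \<open>Jacobi--Trudi determinants and the complete sequence\<close>

text \<open>The dual Jacobi--Trudi determinant of an \<open>a\<close> by \<open>m\<close> rectangle,
  with \<open>t\<close> in the role of the elementary symmetric functions. Indices are integers
  because \<open>a - i + j\<close> may leave the range of rows; the spectral arguments are centred
  at \<open>k\<close>.\<close>

definition jacobi_trudi :: "(int \<Rightarrow> int \<Rightarrow> 'a::comm_ring_1) \<Rightarrow> int \<Rightarrow> nat \<Rightarrow> int \<Rightarrow> 'a" where
  "jacobi_trudi t a m k
    = det (mat m m (\<lambda>(i, j). t (a - int i + int j) (k + int i + int j - int m + 1)))"

lemma jacobi_trudi_0 [simp]: "jacobi_trudi t a 0 k = 1"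
  by (simp add: jacobi_trudi_def)

lemma jacobi_trudi_1 [simp]: "jacobi_trudi t a (Suc 0) k = t a k"
  by (simp add: jacobi_trudi_def det_single)

text \<open>Deleting equal corners of the matrix shifts \<open>k\<close>, deleting opposite corners
  shifts \<open>a\<close>, so Desnanot--Jacobi becomes the T-relation.\<close>

lemma jacobi_trudi_rec:
  "jacobi_trudi t a (Suc (Suc m)) k * jacobi_trudi t a m k
    = jacobi_trudi t a (Suc m) (k + 1) * jacobi_trudi t a (Suc m) (k - 1)
      - jacobi_trudi t (a - 1) (Suc m) k * jacobi_trudi t (a + 1) (Suc m) k"
proof -
  let ?M = "\<lambda>a m k. mat m m (\<lambda>(i, j). t (a - int i + int j) (k + int i + int j - int m + 1))"
  let ?A = "?M a (Suc (Suc m)) k"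
  have "mat_delete ?A 0 0 = ?M a (Suc m) (k + 1)"
    "mat_delete ?A (Suc m) (Suc m) = ?M a (Suc m) (k - 1)"
    "mat_delete ?A 0 (Suc m) = ?M (a - 1) (Suc m) k"
    "mat_delete ?A (Suc m) 0 = ?M (a + 1) (Suc m) k"
    "mat_delete (mat_delete ?A 0 0) m m = ?M a m k"
    by (rule eq_matI; auto simp: mat_delete_def algebra_simps)+
  then show ?thesis
    unfolding jacobi_trudi_def using desnanot_jacobi[of ?A m] by simp
qed

lemma jacobi_trudi_bottom:
  assumes "\<And>d k. d < 0 \<Longrightarrow> t d k = 0" "\<And>k. t 0 k = 1"
  shows "jacobi_trudi t 0 m k = 1"
  unfolding jacobi_trudi_def
  by (subst det_upper_triangular[of _ m])
    (auto simp: upper_triangular_def prod_list_diag_prod assms)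

lemma jacobi_trudi_top:
  assumes "\<And>d k. d > h \<Longrightarrow> t d k = 0" "\<And>k. t h k = - 1"
  shows "jacobi_trudi t h m k = (- 1) ^ m"
  unfolding jacobi_trudi_def
  by (subst det_lower_triangular[of m]) (auto simp: prod_list_diag_prod assms)

text \<open>The spectral argument is symmetric in \<open>i\<close> and \<open>j\<close>, so skewness
  of \<open>t\<close> about \<open>c\<close> makes the matrix alternating.\<close>

lemma jacobi_trudi_alternating:
  assumes "\<And>d k. t (c + d) k = - t (c - d) k" "\<And>k. t c k = 0" "odd m"
  shows "jacobi_trudi t c m k = 0"
  unfolding jacobi_trudi_def
proof (rule det_alternating_odd)
  fix i j assume "i < m" "j < m"
  then show "mat m m (\<lambda>(i, j). t (c - int i + int j) (k + int i + int j - int m + 1)) $$ (i, j)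
    = - mat m m (\<lambda>(i, j). t (c - int i + int j) (k + int i + int j - int m + 1)) $$ (j, i)"
    using assms(1)[of "int j - int i"] by (simp add: algebra_simps)
qed (use assms in auto)

text \<open>The analogue of the complete homogeneous symmetric functions; along a light cone it is the row
a = 1 of the T-system, see complete_seq_eq_S below.\<close>

function complete_seq :: "(int \<Rightarrow> int \<Rightarrow> 'a::comm_ring_1) \<Rightarrow> int \<Rightarrow> nat \<Rightarrow> 'a" where
  "complete_seq t c n = (if n = 0 then 1 else
    \<Sum>j = 1..n. (- 1) ^ Suc j * t (int j) (c - 2 * int n + int j) * complete_seq t c (n - j))"
  by auto
termination by (relation "measure (\<lambda>(t, c, n). n)") auto

declare complete_seq.simps [simp del]

lemma complete_seq_0 [simp]: "complete_seq t c 0 = 1"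
  by (simp add: complete_seq.simps)

text \<open>The spectral version of the relation between elementary and complete symmetric
  functions; the defining recursion is this relation solved for its term
  \<open>j = 0\<close>.\<close>

lemma complete_seq_recurrence:
  assumes "\<And>k. t 0 k = 1" "n > 0"
  shows "(\<Sum>j\<le>n. (- 1) ^ j * t (int j) (c - 2 * int n + int j) * complete_seq t c (n - j)) = 0"
proof -
  have "(\<Sum>j\<le>n. (- 1) ^ j * t (int j) (c - 2 * int n + int j) * complete_seq t c (n - j))
    = complete_seq t c n
      + (\<Sum>j = 1..n. (- 1) ^ j * t (int j) (c - 2 * int n + int j) * complete_seq t c (n - j))"
    by (simp add: atMost_atLeast0 sum.atLeast_Suc_atMost assms)
  also have "complete_seq t c n
      = - (\<Sum>j = 1..n. (- 1) ^ j * t (int j) (c - 2 * int n + int j) * complete_seq t c (n - j))"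
    by (subst complete_seq.simps) (use assms(2) in \<open>simp add: sum_negf\<close>)
  finally show ?thesis by simp
qed

lemma sum_lessThan_add:
  fixes f :: "nat \<Rightarrow> 'a::comm_monoid_add"
  shows "(\<Sum>j<m + n. f j) = (\<Sum>j<m. f j) + (\<Sum>j<n. f (m + j))"
  by (induction n) (simp_all add: add.assoc)

text \<open>The vector y of signed entries of the sequence is mapped to a multiple of the first unit
vector, and Cramer's rule is applied to its last entry.\<close>

lemma jacobi_trudi_Suc_Suc:
  assumes neg: "\<And>d k. d < 0 \<Longrightarrow> t d k = 0" and one: "\<And>k. t 0 k = 1"
    and c: "c = k + int p + int b + 1"
    and zero: "\<And>n. p < n \<Longrightarrow> n \<le> p + b \<Longrightarrow> complete_seq t c n = 0"
  shows "jacobi_trudi t (int b + 1) (Suc p) k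
    = (- 1) ^ b * complete_seq t c (Suc (p + b)) * jacobi_trudi t (int b) p k"
proof -
  let ?x = "complete_seq t c"
  define M where "M = mat (Suc p) (Suc p)
    (\<lambda>(i, j). t (int b + 1 - int i + int j) (k + int i + int j - int (Suc p) + 1))"
  define y where "y = vec (Suc p) (\<lambda>j. (- 1) ^ j * ?x (p - j))"
  have M: "M \<in> carrier_mat (Suc p) (Suc p)" and y: "y \<in> carrier_vec (Suc p)"
    by (simp_all add: M_def y_def)
  have My: "(M *\<^sub>v y) $ i = (if i = 0 then (- 1) ^ b * ?x (Suc (p + b)) else 0)" if i: "i < Suc p" for i
  proof -
    have e: "(M *\<^sub>v y) $ i = (\<Sum>j\<le>p. t (int b + 1 - int i + int j) (k + int i + int j - int p)
        * ((- 1) ^ j * ?x (p - j)))"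
      using i by (auto simp: M_def y_def scalar_prod_def atLeast0LessThan lessThan_Suc_atMost
        algebra_simps intro!: sum.cong)
    show ?thesis
    proof (cases "i \<le> b")
      case True
      \<comment> \<open>Row \<open>i\<close> is, up to sign, the tail \<open>J \<ge> s\<close> of
        the recurrence at index \<open>p + s\<close>; the value of \<open>c\<close> matches the
        spectral arguments. Of the terms before it only \<open>J = 0\<close> survives
        \<open>zero\<close>, and that one is nonzero at most for \<open>i = 0\<close>.\<close>
      define s where "s = b + 1 - i"
      have s: "s > 0" "int s = int b + 1 - int i" using True by (auto simp: s_def)
      define F where "F J = (- 1) ^ J * t (int J) (c - 2 * int (p + s) + int J) * ?x (p + s - J)" for J
      have "(\<Sum>J\<le>p + s. F J) = 0"
        unfolding F_def by (rule complete_seq_recurrence) (use one s in auto)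
      also have "(\<Sum>J\<le>p + s. F J) = (\<Sum>J<s. F J) + (\<Sum>j\<le>p. F (s + j))"
      proof -
        have "(\<Sum>J\<le>p + s. F J) = (\<Sum>J<s + Suc p. F J)"
          by (simp add: lessThan_Suc_atMost add.commute)
        also have "\<dots> = (\<Sum>J<s. F J) + (\<Sum>j<Suc p. F (s + j))"
          by (rule sum_lessThan_add)
        finally show ?thesis by (simp add: lessThan_Suc_atMost)
      qed
      also have "(\<Sum>J<s. F J) = ?x (p + s)"
      proof -
        have "F J = 0" if "0 < J" "J < s" for J
          using that i by (simp add: F_def zero s_def)
        then have "(\<Sum>J<s. F J) = (\<Sum>J<s. if J = 0 then F 0 else 0)"
          by (intro sum.cong) auto
        then show ?thesis using s(1) by (simp add: F_def one)
      qed
      finally have f: "(\<Sum>j\<le>p. F (s + j)) = - ?x (p + s)" by (simp add: add_eq_0_iff)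
      have "(M *\<^sub>v y) $ i = (\<Sum>j\<le>p. (- 1) ^ s * F (s + j))"
        unfolding e
      proof (rule sum.cong[OF refl])
        fix j assume "j \<in> {..p}"
        have "c - 2 * int (p + s) + int (s + j) = k + int i + int j - int p"
          using s by (simp add: c)
        moreover have "int (s + j) = int b + 1 - int i + int j" using s(2) by simp
        ultimately have "F (s + j) = (- 1) ^ (s + j)
            * (t (int b + 1 - int i + int j) (k + int i + int j - int p) * ?x (p - j))"
          unfolding F_def by (simp only: mult.assoc add_diff_cancel_left diff_diff_left
            add.commute[of p s])
        moreover have "(- 1 :: 'a) ^ s * ((- 1) ^ (s + j) * z) = (- 1) ^ j * z" for z
          by (simp add: power_add flip: mult.assoc power_mult_distrib)
        ultimately show "t (int b + 1 - int i + int j) (k + int i + int j - int p)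
            * ((- 1) ^ j * ?x (p - j)) = (- 1) ^ s * F (s + j)"
          by (simp only: mult.left_commute)
      qed
      also have "\<dots> = (- 1) ^ s * (- ?x (p + s))"
        by (simp add: f flip: sum_distrib_left)
      also have "\<dots> = (if i = 0 then (- 1) ^ b * ?x (Suc (p + b)) else 0)"
        using True i by (auto simp: s_def zero)
      finally show ?thesis .
    next
      case False
      \<comment> \<open>The first \<open>d\<close> entries of this row have negative index and
        vanish; the rest form the whole recurrence at index \<open>p - d\<close>, which is
        positive.\<close>
      define d where "d = i - (b + 1)"
      have d: "d < p" "int d = int i - int b - 1" using False i by (auto simp: d_def)
      define F where "F J = (- 1) ^ J * t (int J) (c - 2 * int (p - d) + int J) * ?x (p - d - J)" for J
      let ?g = "\<lambda>j. t (int b + 1 - int i + int j) (k + int i + int j - int p)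
        * ((- 1) ^ j * ?x (p - j))"
      have g: "?g (d + J) = (- 1) ^ d * F J" for J
      proof -
        have "c - 2 * int (p - d) + int J = k + int i + int (d + J) - int p"
          using d by (simp add: c of_nat_diff)
        moreover have "int b + 1 - int i + int (d + J) = int J" using d(2) by simp
        moreover have "p - d - J = p - (d + J)" by simp
        ultimately show ?thesis
          unfolding F_def by (simp only: power_add mult.assoc mult.left_commute)
      qed
      have "(M *\<^sub>v y) $ i = (\<Sum>j<d + Suc (p - d). ?g j)"
        unfolding e using d(1) by (intro sum.cong) auto
      also have "\<dots> = (\<Sum>j<d. ?g j) + (\<Sum>J<Suc (p - d). ?g (d + J))"
        by (rule sum_lessThan_add)
      also have "(\<Sum>j<d. ?g j) = 0"
      proof (rule sum.neutral, rule ballI)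
        fix j assume "j \<in> {..<d}"
        then have "int b + 1 - int i + int j < 0" using d(2) by simp
        then show "?g j = 0" by (simp only: neg mult_zero_left)
      qed
      also have "(\<Sum>J<Suc (p - d). ?g (d + J)) = (- 1) ^ d * (\<Sum>J\<le>p - d. F J)"
        unfolding g by (simp add: lessThan_Suc_atMost sum_distrib_left)
      also have "(\<Sum>J\<le>p - d. F J) = 0"
        unfolding F_def by (rule complete_seq_recurrence) (use one d in auto)
      finally show ?thesis using False by simp
    qed
  qed
  let ?R = "replace_col M (M *\<^sub>v y) p"
  have R: "?R \<in> carrier_mat (Suc p) (Suc p)" using M by (simp add: replace_col_def)
  have Rp: "?R $$ (i, p) = (if i = 0 then (- 1) ^ b * ?x (Suc (p + b)) else 0)" if "i < Suc p" for i
    using that M My[OF that] by (simp add: replace_col_def)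
  have "det ?R = y $ p * det M"
    by (rule cramer_lemma_mat[OF M y]) simp
  also have "y $ p = (- 1) ^ p" by (simp add: y_def)
  finally have 1: "det ?R = (- 1) ^ p * det M" .
  have "det ?R = (\<Sum>i<Suc p. ?R $$ (i, p) * cofactor ?R i p)"
    by (rule laplace_expansion_column[OF R]) simp
  also have "\<dots> = (- 1) ^ b * ?x (Suc (p + b)) * cofactor ?R 0 p"
    by (subst sum.lessThan_Suc_shift) (simp add: Rp)
  \<comment> \<open>Deleting row 0 and the replaced column leaves a Jacobi--Trudi matrix with
    \<open>b + 1\<close> lowered to \<open>b\<close> and the same \<open>k\<close>.\<close>
  also have "mat_delete ?R 0 p = mat p p
    (\<lambda>(i, j). t (int b - int i + int j) (k + int i + int j - int p + 1))"
    by (rule eq_matI) (auto simp: mat_delete_def replace_col_def M_def algebra_simps)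
  then have "cofactor ?R 0 p = (- 1) ^ p * jacobi_trudi t (int b) p k"
    by (simp add: cofactor_def jacobi_trudi_def)
  finally have 2: "(- 1) ^ p * det M = (- 1) ^ p *
      ((- 1) ^ b * ?x (Suc (p + b)) * jacobi_trudi t (int b) p k)"
    using 1 by (simp add: mult_ac)
  have "(- 1 :: 'a) ^ p * ((- 1) ^ p * z) = z" for z
    by (simp flip: mult.assoc power_mult_distrib)
  then have "det M = (- 1) ^ b * ?x (Suc (p + b)) * jacobi_trudi t (int b) p k"
    using arg_cong[OF 2, of "\<lambda>z. (- 1) ^ p * z"] by simp
  then show ?thesis by (simp add: jacobi_trudi_def M_def)
qed

section \<open>Solutions of the T-system as Jacobi--Trudi determinants\<close>

lemma unit_cancel:
  fixes u :: "'a::comm_monoid_mult"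
  assumes "u dvd 1" "x * u = y * u"
  shows "x = y"
proof -
  from assms(1) obtain v where "1 = u * v" by blast
  then show ?thesis using assms(2) by (metis mult.assoc mult.right_neutral)
qed

locale T_sol =
  fixes r l :: nat and S :: "nat \<Rightarrow> nat \<Rightarrow> int \<Rightarrow> 'a::comm_ring_1"
  assumes r: "r > 0" and l: "l > 0" and sol: "is_T_sol r l S"
begin

abbreviation "h \<equiv> 2 * r + 2"
abbreviation "L \<equiv> 2 * l"

lemma unit: "1 \<le> a \<Longrightarrow> a < h \<Longrightarrow> 1 \<le> m \<Longrightarrow> m < L \<Longrightarrow> a \<noteq> r + 1 \<or> even m \<Longrightarrow> S a m k dvd 1"
  and mid: "1 \<le> m \<Longrightarrow> m < L \<Longrightarrow> odd m \<Longrightarrow> S (r + 1) m k = 0"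
  and row_0: "1 \<le> a \<Longrightarrow> a < h \<Longrightarrow> S a 0 k = 1"
  and row_L: "1 \<le> a \<Longrightarrow> a < h \<Longrightarrow> S a L k = 1"
  and col_0: "1 \<le> m \<Longrightarrow> m < L \<Longrightarrow> S 0 m k = 1"
  and col_h: "1 \<le> m \<Longrightarrow> m < L \<Longrightarrow> S h m k = (- 1) ^ m"
  and T_rel: "1 \<le> a \<Longrightarrow> a < h \<Longrightarrow> 1 \<le> m \<Longrightarrow> m < L \<Longrightarrow>
    S a m (k - 1) * S a m (k + 1) = S a (m - 1) k * S a (m + 1) k + S (a - 1) m k * S (a + 1) m k"
  and quasi_sym: "1 \<le> a \<Longrightarrow> a < h \<Longrightarrow> 1 \<le> m \<Longrightarrow> m < L \<Longrightarrow> S a m k = (- 1) ^ m * S (h - a) m k"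
proof -
  have A: "a \<in> {1..2 * r + 1} \<longleftrightarrow> 1 \<le> a \<and> a < h" for a by auto
  have B: "m \<in> {1..2 * l - 1} \<longleftrightarrow> 1 \<le> m \<and> m < L" for m using l by auto
  note s = sol[unfolded is_T_sol_def Ball_def A B]
  note s1 = conjunct2[OF s] note s2 = conjunct2[OF s1] note s3 = conjunct2[OF s2]
  note s4 = conjunct2[OF s3]
  note fs = conjunct1[OF s] conjunct1[OF s1] conjunct1[OF s2] conjunct1[OF s3]
    conjunct1[OF s4] conjunct2[OF s4]
  show "1 \<le> a \<Longrightarrow> a < h \<Longrightarrow> 1 \<le> m \<Longrightarrow> m < L \<Longrightarrow> a \<noteq> r + 1 \<or> even m \<Longrightarrow> S a m k dvd 1"
    by (rule fs(1)[rule_format]) auto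
  show "1 \<le> m \<Longrightarrow> m < L \<Longrightarrow> odd m \<Longrightarrow> S (r + 1) m k = 0"
    by (rule fs(2)[rule_format]) auto
  show "1 \<le> a \<Longrightarrow> a < h \<Longrightarrow> S a 0 k = 1" "1 \<le> a \<Longrightarrow> a < h \<Longrightarrow> S a L k = 1"
    by (rule fs(3)[rule_format, THEN conjunct1] fs(3)[rule_format, THEN conjunct2]; simp)+
  show "1 \<le> m \<Longrightarrow> m < L \<Longrightarrow> S 0 m k = 1" "1 \<le> m \<Longrightarrow> m < L \<Longrightarrow> S h m k = (- 1) ^ m"
    by (rule fs(4)[rule_format, THEN conjunct1] fs(4)[rule_format, THEN conjunct2]; simp)+
  show "1 \<le> a \<Longrightarrow> a < h \<Longrightarrow> 1 \<le> m \<Longrightarrow> m < L \<Longrightarrow>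
      S a m (k - 1) * S a m (k + 1) = S a (m - 1) k * S a (m + 1) k + S (a - 1) m k * S (a + 1) m k"
    by (rule fs(5)[rule_format]) auto
  show "1 \<le> a \<Longrightarrow> a < h \<Longrightarrow> 1 \<le> m \<Longrightarrow> m < L \<Longrightarrow> S a m k = (- 1) ^ m * S (h - a) m k"
    by (rule fs(6)[rule_format]) auto
qed

definition t :: "int \<Rightarrow> int \<Rightarrow> 'a" where
  "t d k = (if 0 \<le> d \<and> d \<le> int h then S (nat d) 1 k else 0)"

lemma t_neg: "d < 0 \<Longrightarrow> t d k = 0"
  and t_large: "d > int h \<Longrightarrow> t d k = 0"
  by (auto simp: t_def)

lemma t_0: "t 0 k = 1"
  using col_0[of 1] l by (simp add: t_def)

lemma t_h: "t (int h) k = - 1"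
  using col_h[of 1] l by (simp add: t_def nat_add_distrib nat_mult_distrib)

lemma t_mid: "t (int (r + 1)) k = 0"
  using mid[of 1] l by (simp add: t_def del: of_nat_add of_nat_Suc)

text \<open>Quasi-symmetry at \<open>m = 1\<close>; the boundary values 1 and -1 and the extension
  by zero obey the same rule.\<close>

lemma t_skew: "t (int (r + 1) + d) k = - t (int (r + 1) - d) k"
proof -
  have half: "t (int (r + 1) + int d) k = - t (int (r + 1) - int d) k" for d
  proof -
    consider "d = r + 1" | "d > r + 1" | "d < r + 1" by linarith
    then show ?thesis
    proof cases
      case 1
      then show ?thesis using t_h[of k] t_0[of k] by (simp add: algebra_simps)
    next
      case 2
      then show ?thesis by (simp add: t_neg t_large)
    next
      case 3
      then have n: "nat (int (r + 1) + int d) = r + 1 + d" "nat (int (r + 1) - int d) = r + 1 - d"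
        by (simp_all add: nat_add_distrib nat_diff_distrib')
      have "S (r + 1 + d) 1 k = (- 1) ^ 1 * S (h - (r + 1 + d)) 1 k"
        by (rule quasi_sym) (use 3 l in auto)
      moreover have "h - (r + 1 + d) = r + 1 - d" by simp
      ultimately show ?thesis unfolding t_def n using 3 by simp
    qed
  qed
  show ?thesis
  proof (cases "d \<ge> 0")
    case True
    then show ?thesis using half[of "nat d"] by simp
  next
    case False
    then show ?thesis using half[of "nat (- d)"] by simp
  qed
qed

lemma t_sym: "t (int h - d) k = - t d k"
  using t_skew[of "int (r + 1) - d" k] by (simp add: algebra_simps)

lemma jt_0: "jacobi_trudi t 0 m k = 1"
  by (rule jacobi_trudi_bottom) (auto simp: t_neg t_0)

lemma jt_h: "jacobi_trudi t (int h) m k = (- 1) ^ m"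
  by (rule jacobi_trudi_top) (use t_large t_h in auto)

lemma jt_mid: "odd m \<Longrightarrow> jacobi_trudi t (int (r + 1)) m k = 0"
  by (rule jacobi_trudi_alternating[OF t_skew t_mid])

text \<open>Both sides obey the T-relation and agree at \<open>m = 0\<close> and
  \<open>m = 1\<close>, so going up in \<open>m\<close> only requires division by
  \<open>S a (m - 2) k\<close>. Where this may be zero, at \<open>a = r + 1\<close> with
  \<open>m\<close> odd, both sides vanish.\<close>

lemma jt_eq_S: "m \<le> L \<Longrightarrow> 1 \<le> a \<Longrightarrow> a < h \<Longrightarrow> jacobi_trudi t (int a) m k = S a m k"
proof (induction m arbitrary: a k rule: less_induct)
  case (less m)
  consider "m = 0" | "m = 1" | n where "m = Suc (Suc n)"
    by (metis One_nat_def not0_implies_Suc)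
  then show ?case
  proof cases
    case 1
    then show ?thesis using less.prems by (simp add: row_0)
  next
    case 2
    then show ?thesis using less.prems by (simp add: t_def)
  next
    case 3
    show ?thesis
    proof (cases "a = r + 1 \<and> odd m")
      case True
      \<comment> \<open>\<open>L\<close> is even and \<open>m\<close> odd, so
        \<open>m \<le> L\<close> is strict and \<open>mid\<close> applies.\<close>
      then have "m < L" using less.prems by (metis dvd_triv_left order_le_less)
      then show ?thesis using True mid[of m k] jt_mid[of m k] less.prems 3 by simp
    next
      case False
      have m1: "jacobi_trudi t (int b) (Suc n) k' = S b (Suc n) k'" if b: "b \<le> h" for b k'
      proof -
        consider "b = 0" | "b = h" | "1 \<le> b" "b < h" using b by linarith
        then show ?thesis
        proof cases
          case 1
          then show ?thesis using less.prems 3 by (simp add: jt_0 col_0)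
        next
          case 2
          then show ?thesis using less.prems 3 jt_h[of "Suc n" k'] col_h[of "Suc n" k'] by simp
        next
          case inner: 3
          then show ?thesis using less.IH[of "Suc n" b k'] less.prems 3 by simp
        qed
      qed
      have m0: "jacobi_trudi t (int a) n k = S a n k"
        using less.IH[of n a k] less.prems 3 by simp
      \<comment> \<open>\<open>n\<close> has the parity of \<open>m\<close>, so the exceptional zero
        is excluded; \<open>n = 0\<close> lies outside the range of \<open>unit\<close>.\<close>
      have "S a n k dvd 1"
      proof (cases "n = 0")
        case True
        then show ?thesis using row_0 less.prems by simp
      next
        case n: False
        show ?thesis by (rule unit) (use less.prems n False 3 in auto)
      qed
      moreover have "jacobi_trudi t (int a) m k * S a n k = S a m k * S a n k"
      proof -
        have "jacobi_trudi t (int a) m k * S a n k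
          = S a (Suc n) (k + 1) * S a (Suc n) (k - 1) - S (a - 1) (Suc n) k * S (a + 1) (Suc n) k"
          using jacobi_trudi_rec[of t "int a" n k] m0 m1[of a] m1[of "a - 1"] m1[of "a + 1"] less.prems 3
          by (simp add: of_nat_diff add.commute)
        also have "\<dots> = S a m k * S a n k"
          using T_rel[of a "Suc n" k] less.prems 3 by (simp add: algebra_simps)
        finally show ?thesis .
      qed
      ultimately show ?thesis by (rule unit_cancel)
    qed
  qed
qed

text \<open>The value at \<open>a = h\<close> is also 1 because \<open>L\<close> is even.\<close>

lemma jt_L: "a \<le> h \<Longrightarrow> jacobi_trudi t (int a) L k = 1"
proof -
  assume "a \<le> h"
  then consider "a = 0" | "a = h" | "1 \<le> a" "a < h" by linarith
  then show ?thesis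
    by cases (use jt_0 jt_h[of L k] jt_eq_S row_L in auto)
qed

text \<open>All determinants of size \<open>L\<close> are 1, so the recursion gives 1 - 1 = 0 after
  division by \<open>S a (L - 1) k\<close>. As \<open>L - 1\<close> is odd, this is no unit at
  \<open>a = r + 1\<close>; there the matrix is alternating of odd size.\<close>

lemma jt_Suc_L:
  assumes "1 \<le> a" "a < h"
  shows "jacobi_trudi t (int a) (Suc L) k = 0"
proof (cases "a = r + 1")
  case True
  then show ?thesis using jt_mid[of "Suc L" k] by simp
next
  case False
  obtain n where n: "L = Suc n" using l by (cases L) auto
  have "1 \<le> n" "n < L" using n l by linarith+
  then have "S a n k dvd 1" by (intro unit) (use assms False in auto)
  moreover have "jacobi_trudi t (int a) (Suc L) k * S a n k = 0 * S a n k"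
    using jacobi_trudi_rec[of t "int a" n k] jt_L[of a] jt_L[of "a - 1" k] jt_L[of "a + 1" k]
      jt_eq_S[of n a k] assms
    unfolding n by (simp add: of_nat_diff add.commute)
  ultimately show ?thesis by (rule unit_cancel)
qed

section \<open>The row \<open>a = 1\<close> as a complete sequence\<close>

text \<open>The case \<open>b = 0\<close> of \<open>jacobi_trudi_Suc_Suc\<close>: its vanishing
  hypothesis is empty and the determinant on its right is 1.\<close>

lemma complete_seq_eq_S: "n \<le> L \<Longrightarrow> complete_seq t c n = S 1 n (c - int n)"
proof (cases n)
  case 0
  then show ?thesis using row_0[of 1] by simp
next
  case (Suc p)
  assume "n \<le> L"
  have "jacobi_trudi t (int 0 + 1) (Suc p) (c - int n)
    = (- 1) ^ 0 * complete_seq t c (Suc (p + 0)) * jacobi_trudi t (int 0) p (c - int n)"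
    by (rule jacobi_trudi_Suc_Suc) (use t_neg t_0 Suc in auto)
  then show ?thesis
    using jt_eq_S[of n 1 "c - int n"] \<open>n \<le> L\<close> Suc jt_0 by simp
qed

text \<open>With \<open>p = L\<close> and the earlier zeros, \<open>jacobi_trudi_Suc_Suc\<close>
  identifies the entry at \<open>L + 1 + b\<close>, up to sign, with a determinant of size
  \<open>L + 1\<close> in row \<open>b + 1 < h\<close>, since the factor of size \<open>L\<close> is
  1.\<close>

lemma complete_seq_vanish: "L < n \<Longrightarrow> n < L + h \<Longrightarrow> complete_seq t c n = 0"
proof (induction n rule: less_induct)
  case (less n)
  define b where "b = n - Suc L"
  have n: "n = Suc (L + b)" using less.prems by (simp add: b_def)
  have "jacobi_trudi t (int b + 1) (Suc L) (c - int n)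
    = (- 1) ^ b * complete_seq t c (Suc (L + b)) * jacobi_trudi t (int b) L (c - int n)"
    by (rule jacobi_trudi_Suc_Suc) (use t_neg t_0 less n in auto)
  moreover have "jacobi_trudi t (int (Suc b)) (Suc L) (c - int n) = 0"
    by (rule jt_Suc_L) (use less.prems n in auto)
  ultimately have z: "(- 1) ^ b * complete_seq t c n = 0"
    using jt_L[of b "c - int n"] less.prems n by (simp add: add.commute)
  have "(- 1 :: 'a) ^ b * ((- 1) ^ b * z) = z" for z
    by (simp flip: mult.assoc power_mult_distrib)
  then show ?case using arg_cong[OF z, of "\<lambda>z. (- 1) ^ b * z"] by simp
qed

section \<open>Reflection and half-periodicity of the row \<open>a = 1\<close>\<close>

text \<open>The T-relation is symmetric in \<open>k - 1\<close> and \<open>k + 1\<close>. This lets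
  \<open>complete_seq_eq_S\<close> be applied to the reflected solution too.\<close>

lemma T_sol_reflect: "T_sol r l (\<lambda>a m k. S a m (- k))"
proof
  show "is_T_sol r l (\<lambda>a m k. S a m (- k))"
    unfolding is_T_sol_def
  proof (intro conjI ballI allI impI)
    fix a m k assume a: "a \<in> {1..2 * r + 1}" and m: "m \<in> {1..2 * l - 1}"
    then have *: "1 \<le> a" "a < h" "1 \<le> m" "m < L" by auto
    show "S a m (- k) dvd 1" if "a \<noteq> r + 1 \<or> even m" by (rule unit) (use that * in auto)
    show "S a m (- (k - 1)) * S a m (- (k + 1))
      = S a (m - 1) (- k) * S a (m + 1) (- k) + S (a - 1) m (- k) * S (a + 1) m (- k)"
      using T_rel[OF *, of "- k"] by (simp add: mult.commute)
    show "S a m (- k) = (- 1) ^ m * S (2 * r + 2 - a) m (- k)"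
      by (rule quasi_sym[OF *])
  next
    fix m k assume m: "m \<in> {1..2 * l - 1}"
    then have *: "1 \<le> m" "m < L" by auto
    show "S (r + 1) m (- k) = 0" if "odd m" by (rule mid[OF * that])
    show "S 0 m (- k) = 1" by (rule col_0[OF *])
    show "S (2 * r + 2) m (- k) = (- 1) ^ m" by (rule col_h[OF *])
  next
    fix a k assume "a \<in> {1..2 * r + 1}"
    then have *: "1 \<le> a" "a < h" by auto
    show "S a 0 (- k) = 1" "S a (2 * l) (- k) = 1" by (rule row_0[OF *], rule row_L[OF *])
  qed
qed (use r l in auto)

text \<open>By the vanishing above, the recurrence can be run backwards from index L; the symmetry of
its coefficients turns it into the recurrence of the reflected solution.\<close>

lemma complete_seq_reverse:
  "m \<le> L \<Longrightarrow> complete_seq t c (L - m)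
    = complete_seq (\<lambda>d k. t d (- k)) (2 * int (L + h) - int h - c) m"
proof (induction m rule: less_induct)
  case (less m)
  let ?x = "complete_seq t c"
  define c' where "c' = 2 * int (L + h) - int h - c"
  let ?z = "complete_seq (\<lambda>d k. t d (- k)) c'"
  show ?case
  proof (cases "m = 0")
    case True
    then show ?thesis using complete_seq_eq_S[of L c] row_L[of 1] by simp
  next
    case False
    \<comment> \<open>The recurrence of order \<open>h\<close> at this index reaches down exactly to
      the wanted entry at \<open>n - h = L - m\<close>.\<close>
    define n where "n = L + h - m"
    have n: "n > 0" "h \<le> n" "int n = int L + int h - int m" using False less.prems by (auto simp: n_def)
    define F where "F J = (- 1) ^ J * t (int J) (c - 2 * int n + int J) * ?x (n - J)" for J
    define G where "G j = (- 1) ^ j * t (int j) (- (c' - 2 * int m + int j)) * ?x (L - m + j)" for j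
    have FG: "F (h - j) = - G j" if "j \<le> h" for j
    proof -
      have "c - 2 * int n + int (h - j) = - (c' - 2 * int m + int j)"
        using that n by (simp add: c'_def of_nat_diff)
      moreover have "t (int (h - j)) k = - t (int j) k" for k
        using t_sym[of "int j"] that by (simp add: of_nat_diff)
      moreover have "(- 1 :: 'a) ^ (h - j) = (- 1) ^ j"
        using that by (simp add: minus_one_power_iff)
      moreover have "n - (h - j) = L - m + j" using that less.prems by (simp add: n_def)
      ultimately show ?thesis by (simp add: F_def G_def)
    qed
    have "0 = (\<Sum>J\<le>n. F J)"
      unfolding F_def by (rule complete_seq_recurrence[symmetric]) (use t_0 n in auto)
    also have "\<dots> = (\<Sum>J\<le>h. F J)"
      by (rule sum.mono_neutral_right) (use n in \<open>auto simp: F_def t_large\<close>)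
    also have "\<dots> = (\<Sum>j\<le>h. F (h - j))"
      using sum.atLeastAtMost_rev[of F 0 h] by (simp add: atLeast0AtMost)
    also have "\<dots> = - (\<Sum>j\<le>h. G j)"
      unfolding sum_negf[symmetric] by (rule sum.cong[OF refl], rule FG) simp
    \<comment> \<open>Terms with \<open>j > m\<close> involve entries strictly between
      \<open>L\<close> and \<open>L + h\<close>, which vanish. If \<open>m > h\<close>, the range is
      then extended to \<open>m\<close> by zero coefficients.\<close>
    also have "(\<Sum>j\<le>h. G j) = (\<Sum>j\<le>min h m. G j)"
    proof (rule sum.mono_neutral_right)
      show "\<forall>j\<in>{..h} - {..min h m}. G j = 0"
      proof
        fix j assume "j \<in> {..h} - {..min h m}"
        then have "?x (L - m + j) = 0"
          by (intro complete_seq_vanish) (use less.prems False in auto)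
        then show "G j = 0" by (simp only: G_def mult_zero_right)
      qed
    qed auto
    also have "\<dots> = (\<Sum>j\<le>m. G j)"
    proof (rule sum.mono_neutral_left)
      show "\<forall>j\<in>{..m} - {..min h m}. G j = 0"
      proof
        fix j assume "j \<in> {..m} - {..min h m}"
        then have "int j > int h" by auto
        then show "G j = 0" by (simp only: G_def t_large mult_zero_right mult_zero_left)
      qed
    qed auto
    finally have "0 = (\<Sum>j\<le>m. G j)" by simp
    also have "\<dots> = G 0 + (\<Sum>j = 1..m. G j)"
      by (simp add: atMost_atLeast0 sum.atLeast_Suc_atMost)
    also have "G 0 = ?x (L - m)" by (simp add: G_def t_0)
    \<comment> \<open>The term \<open>j = 0\<close> is isolated; by induction the others are those
      of the recursion defining \<open>?z m\<close>.\<close>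
    finally have "?x (L - m) = - (\<Sum>j = 1..m. G j)" by (intro iffD2[OF eq_neg_iff_add_eq_0]) (rule sym)
    also have "\<dots> = (\<Sum>j = 1..m. (- 1) ^ Suc j * t (int j) (- (c' - 2 * int m + int j)) * ?z (m - j))"
      unfolding sum_negf[symmetric]
    proof (rule sum.cong[OF refl])
      fix j assume j: "j \<in> {1..m}"
      then have "L - m + j = L - (m - j)" using less.prems by auto
      moreover have "?x (L - (m - j)) = ?z (m - j)"
        unfolding c'_def by (rule less.IH) (use j less.prems in auto)
      ultimately have "?x (L - m + j) = ?z (m - j)" by (simp only:)
      then show "- G j = (- 1) ^ Suc j * t (int j) (- (c' - 2 * int m + int j)) * ?z (m - j)"
        unfolding G_def by (simp only: power_Suc mult_minus_left mult_1_left)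
    qed
    also have "\<dots> = ?z m"
      using False by (subst complete_seq.simps[of _ c' m]) simp
    finally show ?thesis by (simp add: c'_def)
  qed
qed

lemma half_period_1: "m \<le> L \<Longrightarrow> S 1 m (k + int (L + h)) = S 1 (L - m) (k + 2 * int (L + h))"
proof -
  assume m: "m \<le> L"
  interpret R: T_sol r l "\<lambda>a m k. S a m (- k)" by (rule T_sol_reflect)
  have Rt: "R.t = (\<lambda>d k. t d (- k))" by (simp add: fun_eq_iff R.t_def t_def)
  \<comment> \<open>This \<open>c\<close> puts entry \<open>L - m\<close> at argument
    \<open>k + 2 * int (L + h)\<close>; the reflected sequence then has entry \<open>m\<close> at
    \<open>k + int (L + h)\<close> after undoing the sign.\<close>
  define c where "c = k + 2 * int (L + h) + int L - int m"
  have "S 1 (L - m) (k + 2 * int (L + h)) = complete_seq t c (L - m)"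
    using m by (subst complete_seq_eq_S) (simp_all add: c_def of_nat_diff algebra_simps)
  also have "\<dots> = complete_seq R.t (2 * int (L + h) - int h - c) m"
    unfolding Rt by (rule complete_seq_reverse[OF m])
  also have "\<dots> = S 1 m (- (2 * int (L + h) - int h - c - int m))"
    by (rule R.complete_seq_eq_S[OF m])
  also have "- (2 * int (L + h) - int h - c - int m) = k + int (L + h)"
    by (simp add: c_def)
  finally show ?thesis by simp
qed

section \<open>Propagation of half-periodicity to all rows\<close>

text \<open>The T-relation, solved for the row \<open>a + 1\<close>, is invariant under exchanging
  \<open>m\<close> and \<open>L - m\<close>, so two consecutive rows determine the next.\<close>

lemma half_period_lower:
  "a \<le> r \<Longrightarrow> \<forall>m\<in>{0..L}. \<forall>k. S (Suc a) m (k + int (L + h)) = S (Suc a) (L - m) k"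
proof (induction a rule: less_induct)
  case (less a)
  show ?case
  proof (cases a)
    case 0
    show ?thesis
    proof (intro ballI allI)
      fix m k assume "m \<in> {0..L}"
      then have "L - (L - m) = m" by simp
      moreover have "k - int (L + h) + 2 * int (L + h) = k + int (L + h)" by simp
      ultimately show "S (Suc a) m (k + int (L + h)) = S (Suc a) (L - m) k"
        using half_period_1[of "L - m" "k - int (L + h)"] 0
        by (simp only: diff_add_cancel diff_le_self One_nat_def)
    qed
  next
    case (Suc b)
    show ?thesis
    proof (intro ballI allI)
      fix m k assume m: "m \<in> {0..L}"
      let ?N = "int (L + h)"
      consider "m = 0" | "m = L" | "1 \<le> m" "m < L" using m by force
      then show "S (Suc a) m (k + ?N) = S (Suc a) (L - m) k"
      proof cases
        case 1
        then show ?thesis using row_0[of "Suc a"] row_L[of "Suc a"] less.prems by simp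
      next
        case 2
        then show ?thesis using row_0[of "Suc a"] row_L[of "Suc a"] less.prems by simp
      next
        case 3
        have mL: "1 \<le> L - m" "L - m < L" using 3 by auto
        have prev: "S b m (k + ?N) = S b (L - m) k"
        proof (cases b)
          case 0
          then show ?thesis using col_0[OF 3] col_0[OF mL] by simp
        next
          case (Suc d)
          then show ?thesis using less.IH[of d] less.prems \<open>a = Suc b\<close> m by simp
        qed
        \<comment> \<open>The divisor lies in row \<open>b < r\<close>, strictly below the row with
          zeros; row 0 is constantly 1.\<close>
        have u: "S b m (k + ?N) dvd 1"
        proof (cases "b = 0")
          case True
          then show ?thesis using col_0[OF 3] by simp
        next
          case False
          then show ?thesis by (intro unit) (use less.prems Suc 3 in auto)
        qed
        have IH: "S a m' (k' + ?N) = S a (L - m') k'" if "m' \<le> L" for m' k'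
          using less.IH[of b] less.prems Suc that by simp
        have "S (Suc a) m (k + ?N) * S b m (k + ?N)
          = S a m (k + ?N - 1) * S a m (k + ?N + 1) - S a (m - 1) (k + ?N) * S a (m + 1) (k + ?N)"
          using T_rel[of a m "k + ?N"] less.prems Suc 3 by (simp add: algebra_simps)
        also have "\<dots> = S a (L - m) (k - 1) * S a (L - m) (k + 1)
          - S a (L - m + 1) k * S a (L - m - 1) k"
        proof -
          have "k + ?N - 1 = (k - 1) + ?N" "k + ?N + 1 = (k + 1) + ?N" by simp_all
          then have "S a m (k + ?N - 1) = S a (L - m) (k - 1)" "S a m (k + ?N + 1) = S a (L - m) (k + 1)"
            using IH[of m "k - 1"] IH[of m "k + 1"] 3 by (simp_all only: less_imp_le)
          moreover have "L - (m - 1) = L - m + 1" "L - (m + 1) = L - m - 1" using 3 by auto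
          then have "S a (m - 1) (k + ?N) = S a (L - m + 1) k" "S a (m + 1) (k + ?N) = S a (L - m - 1) k"
            using IH[of "m - 1" k] IH[of "m + 1" k] 3 by auto
          ultimately show ?thesis by (simp only:)
        qed
        also have "\<dots> = S (Suc a) (L - m) k * S b m (k + ?N)"
          unfolding prev using T_rel[of a "L - m" k] less.prems Suc mL by (simp add: algebra_simps)
        finally show ?thesis using unit_cancel[OF u] by blast
      qed
    qed
  qed
qed

lemma half_period:
  assumes a: "1 \<le> a" "a < h" and m: "1 \<le> m" "m < L"
  shows "S a m (k + int (L + h)) = S a (L - m) k"
proof -
  have low: "S b m (k + int (L + h)) = S b (L - m) k" if "1 \<le> b" "b \<le> r + 1" for b
    using half_period_lower[of "b - 1"] that m by simp
  show ?thesis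
  proof (cases "a \<le> r + 1")
    case True
    then show ?thesis using low a by simp
  next
    case False
    \<comment> \<open>\<open>m\<close> and \<open>L - m\<close> have equal parity, so the two
      quasi-symmetry signs cancel.\<close>
    have "(- 1 :: 'a) ^ (L - m) = (- 1) ^ m" using m by (simp add: minus_one_power_iff)
    then show ?thesis
      using quasi_sym[OF a m, of "k + int (L + h)"] quasi_sym[OF a, of "L - m" k] low[of "h - a"] False a m
      by simp
  qed
qed

end

theorem theorem6p9:
  fixes r l :: nat and S :: "nat \<Rightarrow> nat \<Rightarrow> int \<Rightarrow> 'a::comm_ring_1"
  assumes "r \<ge> 2" and "l \<ge> 2" and "is_T_sol r l S"
  shows "\<forall>a\<in>{1..2*r+1}. \<forall>m\<in>{1..2*l-1}. \<forall>k::int.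
           S a m (k + 2 * int (r + 1 + l)) = (-1)^m * S (2*r+2-a) (2*l-m) k \<and>
           (-1)^m * S (2*r+2-a) (2*l-m) k = S a (2*l-m) k \<and>
           S a m (k + 4 * int (r + 1 + l)) = S a m k"
proof (intro ballI allI)
  fix a m and k :: int assume "a \<in> {1..2*r+1}" "m \<in> {1..2*l-1}"
  then have a: "1 \<le> a" "a < 2*r+2" and m: "1 \<le> m" "m < 2*l" by auto
  interpret T_sol r l S by unfold_locales (use assms in auto)
  \<comment> \<open>As \<open>k\<close> is twice the spectral parameter, a shift by
    \<open>L + h\<close> in \<open>k\<close> is a shift by \<open>r + 1 + l\<close> in the parameter
    itself.\<close>
  have N: "int (2*l + (2*r+2)) = 2 * int (r + 1 + l)" by simp
  note half = half_period[unfolded N]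
  have mL: "1 \<le> 2*l - m" "2*l - m < 2*l" using m by auto
  \<comment> \<open>Two half-periods send \<open>m\<close> to \<open>2*l - m\<close> and
    back.\<close>
  have "S a m (k + 4 * int (r + 1 + l)) = S a m (k + 2 * int (r + 1 + l) + 2 * int (r + 1 + l))"
    by (simp add: algebra_simps)
  also have "\<dots> = S a m k"
    using half[OF a m, of "k + 2 * int (r + 1 + l)"] half[OF a mL, of k] m by (metis diff_diff_cancel less_imp_le)
  finally have 3: "S a m (k + 4 * int (r + 1 + l)) = S a m k" .
  have "(-1 :: 'a) ^ (2*l - m) = (-1) ^ m" using m by (simp add: minus_one_power_iff)
  then have 2: "(-1)^m * S (2*r+2-a) (2*l-m) k = S a (2*l-m) k"
    using quasi_sym[OF a mL, of k] by simp
  show "S a m (k + 2 * int (r + 1 + l)) = (-1)^m * S (2*r+2-a) (2*l-m) k \<and>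
           (-1)^m * S (2*r+2-a) (2*l-m) k = S a (2*l-m) k \<and>
           S a m (k + 4 * int (r + 1 + l)) = S a m k"
    using half[OF a m] 2 3 by simp
qed

end
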